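(* Consider Brochette first-passage percolation on $\mathbb{Z}^d$, $d\ge2$, with passage time distribution function $F$. If $\mathbb{E}[\min(\tau_1^d,\dots,\tau_d^d)]=+\infty$, where $\tau_1,\dots,\tau_d$ are independent random variables with distribution function $F$, then for any $K>0$, almost surely, $$\frac{T(0,x)}{\lVert x\rVert_1}>K\quad\text{for infinitely many } x\in\mathbb{Z}^d.$$
   Context: Brochette first-passage percolation: let $\mathbb{E}^d$ be the set of edges $\{x,y\}$ with $x,y\in\mathbb{Z}^d$, $\lVert x-y\rVert_1=1$. An integer line is the set of points of $\mathbb{Z}^d$ lying on a common line of $\mathbb{R}^d$ parallel to one of the coordinate axes; $\Delta$ is the set of integer lines. Let $(\tau_\delta)_{\delta\in\Delta}$ be i.i.d. random variables with values in $[0,+\infty)$ and common cumulative distribution function $F$. The passage time $\tau_e$ of an edge $e\in\mathbb{E}^d$ is $\tau_e=\tau_\delta$, where $\delta$ is the unique integer line containing both endpoints of $e$. For $x,y\in\mathbb{Z}^d$, $T(x,y)=\inf_\Gamma\sum_{e\in\Gamma}\tau_e$, the infimum being over finite nearest-neighbour paths $\Gamma$ from $x$ to $y$ (so $T(x,x)=0$). *)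

theory Defs
  imports "HOL-Probability.Probability"
begin

text \<open>
  The lattice \<open>\<int>\<^sup>d\<close> is the type \<^typ>\<open>int ^ 'd\<close>, with \<open>d = CARD('d)\<close>.
\<close>

definition norm_l1 :: "int ^ 'd::finite \<Rightarrow> int" where
  "norm_l1 x = (\<Sum>i\<in>UNIV. \<bar>x $ i\<bar>)"

definition lattice_edges :: "(int ^ 'd::finite) set set" where
  "lattice_edges = {{x, y} | x y. norm_l1 (x - y) = 1}"

definition real_point :: "int ^ 'd::finite \<Rightarrow> real ^ 'd" where
  "real_point x = (\<chi> i. real_of_int (x $ i))"

text \<open>
  Axis-parallel lines of \<open>\<real>\<^sup>d\<close> that contain no lattice point are discarded; without the
  condition \<open>\<delta> \<noteq> {}\<close> the empty set would count as an integer line.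
\<close>

definition integer_lines :: "(int ^ 'd::finite) set set" where
  "integer_lines =
     {\<delta>. \<delta> \<noteq> {} \<and> (\<exists>i p. \<delta> = {x. \<exists>t::real. real_point x = p + t *\<^sub>R axis i 1})}"

definition edge_line :: "(int ^ 'd::finite) set \<Rightarrow> (int ^ 'd) set" where
  "edge_line e = (THE \<delta>. \<delta> \<in> integer_lines \<and> e \<subseteq> \<delta>)"

definition lattice_path :: "int ^ 'd::finite \<Rightarrow> int ^ 'd \<Rightarrow> (int ^ 'd) list \<Rightarrow> bool" where
  "lattice_path x y \<Gamma> \<longleftrightarrow>
     \<Gamma> \<noteq> [] \<and> hd \<Gamma> = x \<and> last \<Gamma> = y \<and> successively (\<lambda>u v. {u, v} \<in> lattice_edges) \<Gamma>"

definition path_edges :: "(int ^ 'd::finite) list \<Rightarrow> (int ^ 'd) set list" where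
  "path_edges \<Gamma> = map (\<lambda>(u, v). {u, v}) (zip \<Gamma> (tl \<Gamma>))"

text \<open>
  Below, \<open>t\<close> is one realisation of the passage times of the lines. An edge that a path crosses
  several times is counted each time. The infimum is taken in \<^typ>\<open>real\<close>; it is
  meaningful for nonnegative \<open>t\<close>, since any two lattice points are joined by a path.
\<close>

definition edge_time :: "((int ^ 'd::finite) set \<Rightarrow> real) \<Rightarrow> (int ^ 'd) set \<Rightarrow> real" where
  "edge_time t e = t (edge_line e)"

definition passage_time ::
  "((int ^ 'd::finite) set \<Rightarrow> real) \<Rightarrow> int ^ 'd \<Rightarrow> int ^ 'd \<Rightarrow> real" where
  "passage_time t x y = (INF \<Gamma>\<in>{\<Gamma>. lattice_path x y \<Gamma>}. \<Sum>e\<leftarrow>path_edges \<Gamma>. edge_time t e)"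

text \<open>Every edge lies on exactly one integer line, so \<^const>\<open>edge_line\<close> is well defined.\<close>

lemma integer_line_eq:
  fixes x :: "int ^ 'd::finite"
  assumes "x \<in> {z. \<exists>t::real. real_point z = p + t *\<^sub>R axis i 1}"
  shows "{z. \<exists>t::real. real_point z = p + t *\<^sub>R axis i 1} = {z. \<forall>j. j \<noteq> i \<longrightarrow> z $ j = x $ j}"
proof -
  from assms obtain s where s: "real_point x = p + s *\<^sub>R axis i 1" by blast
  have p: "p $ j = real_of_int (x $ j)" if "j \<noteq> i" for j
    using arg_cong[OF s, of "\<lambda>v. v $ j"] that by (simp add: real_point_def axis_def)
  show ?thesis
  proof (intro set_eqI iffI)
    fix z :: "int ^ 'd"
    assume "z \<in> {z. \<exists>t::real. real_point z = p + t *\<^sub>R axis i 1}"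
    then obtain t where t: "real_point z = p + t *\<^sub>R axis i 1" by blast
    have "z $ j = x $ j" if "j \<noteq> i" for j
      using arg_cong[OF t, of "\<lambda>v. v $ j"] p[OF that] that
      by (simp add: real_point_def axis_def)
    then show "z \<in> {z. \<forall>j. j \<noteq> i \<longrightarrow> z $ j = x $ j}" by blast
  next
    fix z :: "int ^ 'd"
    assume z: "z \<in> {z. \<forall>j. j \<noteq> i \<longrightarrow> z $ j = x $ j}"
    have "real_point z = p + (real_of_int (z $ i) - p $ i) *\<^sub>R axis i 1"
      using z p by (auto simp: vec_eq_iff real_point_def axis_def)
    then show "z \<in> {z. \<exists>t::real. real_point z = p + t *\<^sub>R axis i 1}" by blast
  qed
qed

lemma integer_lines_iff:
  "\<delta> \<in> integer_lines \<longleftrightarrow> (\<exists>i x. \<delta> = {z :: int ^ 'd::finite. \<forall>j. j \<noteq> i \<longrightarrow> z $ j = x $ j})"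
proof
  assume "\<delta> \<in> integer_lines"
  then obtain i p x where d: "\<delta> = {z. \<exists>t::real. real_point z = p + t *\<^sub>R axis i 1}" and "x \<in> \<delta>"
    unfolding integer_lines_def by blast
  then show "\<exists>i x. \<delta> = {z. \<forall>j. j \<noteq> i \<longrightarrow> z $ j = x $ j}"
    using integer_line_eq[of x p i] by blast
next
  assume "\<exists>i x. \<delta> = {z. \<forall>j. j \<noteq> i \<longrightarrow> z $ j = x $ j}"
  then obtain i x where d: "\<delta> = {z. \<forall>j. j \<noteq> i \<longrightarrow> z $ j = x $ j}" by blast
  have "x \<in> {z. \<exists>t::real. real_point z = real_point x + t *\<^sub>R axis i 1}"
    by (auto intro: exI[of _ 0])
  from integer_line_eq[OF this] d
  have "\<delta> = {z. \<exists>t::real. real_point z = real_point x + t *\<^sub>R axis i 1}" by simp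
  moreover have "x \<in> \<delta>" using d by simp
  ultimately show "\<delta> \<in> integer_lines" unfolding integer_lines_def by blast
qed

lemma ex1_edge_line:
  fixes e :: "(int ^ 'd::finite) set"
  assumes "e \<in> lattice_edges"
  shows "\<exists>!\<delta>. \<delta> \<in> integer_lines \<and> e \<subseteq> \<delta>"
proof -
  from assms obtain x y where e: "e = {x, y}" and n: "norm_l1 (x - y) = 1"
    unfolding lattice_edges_def by blast
  have s: "(\<Sum>i\<in>UNIV. \<bar>x $ i - y $ i\<bar>) = 1" using n by (simp add: norm_l1_def)
  then obtain i where i: "x $ i \<noteq> y $ i" by force
  have "(\<Sum>i\<in>UNIV. \<bar>x $ i - y $ i\<bar>) = \<bar>x $ i - y $ i\<bar> + (\<Sum>j\<in>UNIV - {i}. \<bar>x $ j - y $ j\<bar>)"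
    by (simp add: sum.remove)
  moreover have "(\<Sum>j\<in>UNIV - {i}. \<bar>x $ j - y $ j\<bar>) \<ge> 0" by (simp add: sum_nonneg)
  ultimately have "(\<Sum>j\<in>UNIV - {i}. \<bar>x $ j - y $ j\<bar>) = 0" using s i by linarith
  then have j: "y $ j = x $ j" if "j \<noteq> i" for j
    using that by (auto simp: sum_nonneg_eq_0_iff)
  show ?thesis
  proof (rule ex1I)
    show "{z. \<forall>j. j \<noteq> i \<longrightarrow> z $ j = x $ j} \<in> integer_lines \<and> e \<subseteq> {z. \<forall>j. j \<noteq> i \<longrightarrow> z $ j = x $ j}"
      using j unfolding e integer_lines_iff by blast
  next
    fix \<delta> assume d: "\<delta> \<in> integer_lines \<and> e \<subseteq> \<delta>"
    then obtain k w where k: "\<delta> = {z. \<forall>j. j \<noteq> k \<longrightarrow> z $ j = w $ j}"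
      unfolding integer_lines_iff by blast
    with d e have w: "\<And>j. j \<noteq> k \<Longrightarrow> x $ j = w $ j" "\<And>j. j \<noteq> k \<Longrightarrow> y $ j = w $ j" by auto
    then have "k = i" using i by metis
    then show "\<delta> = {z. \<forall>j. j \<noteq> i \<longrightarrow> z $ j = x $ j}" using k w by auto
  qed
qed

end

theory Submission
  imports Defs
begin

text \<open>
  Every path from the origin to a point \<open>x \<noteq> 0\<close> has to enter \<open>x\<close> along one of the \<open>d\<close> integer lines
  through \<open>x\<close>. If all these lines are slower than \<open>K \<parallel>x\<parallel>\<close>, the last edge alone makes the passage time
  larger than \<open>K \<parallel>x\<parallel>\<close> (\<open>passage_time_gt\<close>). Call such a point slow; it is enough to find, almost
  surely, infinitely many slow points.

  For one point the event has probability \<open>G(K \<parallel>x\<parallel>)\<^sup>d\<close>, where \<open>G = 1 - F\<close>, and the moment hypothesis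
  says exactly that these probabilities have an infinite sum. Points on a common line are
  dependent, however, and a family of points without common lines is in general too sparse to have
  an infinite sum. The points are therefore grouped by scale, with one threshold \<open>2 d K 2\<^sup>k\<close>
  at scale \<open>k\<close>: the box \<open>{2\<^sup>k..<2\<^sup>k\<^sup>+\<^sup>1}\<^sup>d\<close> contains \<open>2\<^sup>k\<^sup>d\<close> points of
  norm at most \<open>2 d 2\<^sup>k\<close>. Since \<open>d \<ge> 2\<close>, every line keeps at least one coordinate fixed, so lines that
  meet different boxes on the diagonal are different, and the events that box \<open>k\<close> contains a slow
  point are independent (\<open>indep_events_slow_point\<close>).

  Within a box put \<open>u = 2\<^sup>k G(2 d K 2\<^sup>k)\<close>. The number of slow points has mean \<open>u\<^sup>d\<close>. Two distinct points
  share at most one line, and only \<open>d 2\<^sup>k\<close> points of the box share a line with a given one; this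
  makes the second moment at most \<open>(d + 2) u\<^sup>d max 1 (u\<^sup>d)\<close>, and the second moment method
  gives a slow point with probability at least \<open>min 1 (u\<^sup>d) / (d + 2)\<close> (\<open>prob_slow_point_ge\<close>). A dyadic
  decomposition of the minimum shows that the numbers \<open>u\<^sup>d\<close> have an infinite sum over all scales
  (\<open>not_summable_dyadic_tail_of_min\<close>), and the second Borel--Cantelli lemma concludes.
\<close>

section \<open>Borel--Cantelli, second moments and dyadic tails\<close>

text \<open>
  If with positive probability \<open>q\<close> no event occurred from index \<open>n\<close> on, then independence and
  \<open>1 - p \<le> exp (- p)\<close> would bound every partial sum of the probabilities from \<open>n\<close> on by \<open>- ln q\<close>.
\<close>

lemma (in prob_space) borel_cantelli_AE2:
  assumes indep: "indep_events E UNIV" and diverges: "\<not> summable (\<lambda>k. prob (E k))"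
  shows "AE \<omega> in M. infinite {k::nat. \<omega> \<in> E k}"
proof -
  have E: "E k \<in> events" for k
    using indep by (auto simp: indep_events_def)
  have "indep_sets (\<lambda>k. sigma_sets (space M) {E k}) UNIV"
    using indep unfolding indep_events_def_alt
    by (rule indep_sets_sigma) (simp add: Int_stable_def)
  then have compl: "prob (\<Inter>k\<in>J. space M - E k) = (\<Prod>k\<in>J. prob (space M - E k))"
    if "finite J" "J \<noteq> {}" for J
    using that by (intro indep_setsD[where I = UNIV]) (auto intro: sigma_sets.intros)
  have none: "prob (space M - (\<Union>k\<in>{n..}. E k)) = 0" for n
  proof (rule ccontr)
    define q where "q = prob (space M - (\<Union>k\<in>{n..}. E k))"
    assume "prob (space M - (\<Union>k\<in>{n..}. E k)) \<noteq> 0"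
    then have q: "q > 0"
      by (simp add: q_def zero_less_measure_iff)
    have "(\<Sum>k<m. prob (E (k + n))) \<le> - ln q" for m
    proof -
      have "q \<le> prob (\<Inter>k\<in>{n..<Suc m + n}. space M - E k)"
        unfolding q_def using E by (intro finite_measure_mono) auto
      also have "\<dots> = (\<Prod>k\<in>{n..<Suc m + n}. 1 - prob (E k))"
        by (subst compl) (auto simp: prob_compl E)
      also have "\<dots> \<le> (\<Prod>k\<in>{n..<Suc m + n}. exp (- prob (E k)))"
        using exp_ge_add_one_self[of "- prob (E _)"] by (intro prod_mono) auto
      also have "\<dots> = exp (- (\<Sum>k\<in>{n..<Suc m + n}. prob (E k)))"
        by (simp add: exp_sum flip: sum_negf del: sum.op_ivl_Suc)
      finally have "ln q \<le> - (\<Sum>k\<in>{n..<Suc m + n}. prob (E k))"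
        using q by (metis exp_gt_zero ln_exp ln_le_cancel_iff)
      moreover have "(\<Sum>k\<in>{n..<Suc m + n}. prob (E k)) = (\<Sum>k<Suc m. prob (E (k + n)))"
        using sum.shift_bounds_nat_ivl[of "\<lambda>k. prob (E k)" 0 n "Suc m"]
        by (simp add: lessThan_atLeast0)
      moreover have "(\<Sum>k<m. prob (E (k + n))) \<le> (\<Sum>k<Suc m. prob (E (k + n)))"
        by simp
      ultimately show ?thesis
        by linarith
    qed
    then have "summable (\<lambda>k. prob (E (k + n)))"
      by (intro bounded_imp_summable[where B = "- ln q"])
        (auto simp: lessThan_Suc_atMost[symmetric] simp del: sum.lessThan_Suc)
    with diverges show False
      by (simp add: summable_iff_shift[of "\<lambda>k. prob (E k)"])
  qed
  have "AE \<omega> in M. \<exists>k\<ge>n. \<omega> \<in> E k" for n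
  proof -
    have "AE \<omega> in M. \<omega> \<in> space M - (space M - (\<Union>k\<in>{n..}. E k))"
      using E none[of n] by (intro AE_prob_1) (subst prob_compl, auto)
    then show ?thesis
      by (rule AE_mp) (auto intro!: AE_I2)
  qed
  then have "AE \<omega> in M. \<forall>n. \<exists>k\<ge>n. \<omega> \<in> E k"
    by (simp add: AE_all_countable)
  then show ?thesis
    by (rule AE_mp) (auto intro!: AE_I2 simp: infinite_nat_iff_unbounded_le)
qed

text \<open>
  With \<open>H\<close> the number of events that occur, \<open>2 c H - c\<^sup>2 H\<^sup>2 = 1 - (1 - c H)\<^sup>2\<close> is at most \<open>1\<close>, and it
  vanishes where \<open>H = 0\<close>; so it lies below the indicator of the union. The best choice of \<open>c\<close>
  is \<open>E H / E H\<^sup>2\<close>, which gives the Paley--Zygmund bound; leaving \<open>c\<close> free makes it possible to insert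
  upper bounds for the second moment.
\<close>

lemma (in prob_space) prob_UN_ge_second_moment:
  assumes S: "finite S" and A: "\<And>x. x \<in> S \<Longrightarrow> A x \<in> events"
  shows "2 * c * (\<Sum>x\<in>S. prob (A x)) - c\<^sup>2 * (\<Sum>x\<in>S. \<Sum>y\<in>S. prob (A x \<inter> A y))
           \<le> prob (\<Union>x\<in>S. A x)"
proof -
  define H :: "'a \<Rightarrow> real" where "H \<omega> = (\<Sum>x\<in>S. indicator (A x) \<omega>)" for \<omega>
  have int: "integrable M (indicator (A x) :: 'a \<Rightarrow> real)"
    "integrable M (indicator (A x \<inter> A y) :: 'a \<Rightarrow> real)" if "x \<in> S" "y \<in> S" for x y
    using A[OF that(1)] A[OF that(2)] by (auto intro!: integrable_real_indicator simp: less_top[symmetric])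
  have H2: "(H \<omega>)\<^sup>2 = (\<Sum>x\<in>S. \<Sum>y\<in>S. indicator (A x \<inter> A y) \<omega>)" for \<omega>
    by (simp add: H_def power2_eq_square sum_product indicator_inter_arith)
  have "2 * c * (\<Sum>x\<in>S. prob (A x)) - c\<^sup>2 * (\<Sum>x\<in>S. \<Sum>y\<in>S. prob (A x \<inter> A y))
      = (\<integral>\<omega>. 2 * c * H \<omega> - c\<^sup>2 * (H \<omega>)\<^sup>2 \<partial>M)"
    unfolding H2 unfolding H_def using int A
    by (simp add: Bochner_Integration.integral_sum sum_distrib_left)
  also have "\<dots> \<le> (\<integral>\<omega>. indicator (\<Union>x\<in>S. A x) \<omega> \<partial>M)"
  proof (rule integral_mono)
    show "integrable M (\<lambda>\<omega>. 2 * c * H \<omega> - c\<^sup>2 * (H \<omega>)\<^sup>2)"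
      unfolding H2 unfolding H_def using int by auto
    show "integrable M (indicator (\<Union>x\<in>S. A x) :: 'a \<Rightarrow> real)"
      using A S by (intro integrable_real_indicator) (auto simp: less_top[symmetric])
    fix \<omega>
    show "2 * c * H \<omega> - c\<^sup>2 * (H \<omega>)\<^sup>2 \<le> indicator (\<Union>x\<in>S. A x) \<omega>"
    proof (cases "\<omega> \<in> (\<Union>x\<in>S. A x)")
      case True
      have "0 \<le> (1 - c * H \<omega>)\<^sup>2" by simp
      then show ?thesis using True by (simp add: power2_eq_square algebra_simps)
    next
      case False
      then have "H \<omega> = 0" by (auto simp: H_def)
      then show ?thesis by simp
    qed
  qed
  also have "\<dots> = prob (\<Union>x\<in>S. A x)"
  proof -
    have "(\<Union>x\<in>S. A x) \<in> events" using A S by auto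
    then show ?thesis by (simp add: sets.Int_space_eq2)
  qed
  finally show ?thesis .
qed

lemma (in prob_space) prob_gt_eq_cdf:
  assumes "X \<in> borel_measurable M"
  shows "prob {\<omega> \<in> space M. X \<omega> > t} = 1 - cdf (distr M borel X) t"
proof -
  have "cdf (distr M borel X) t = prob {\<omega> \<in> space M. X \<omega> \<le> t}"
    using assms by (auto simp: cdf_def measure_distr intro!: arg_cong[where f = prob])
  moreover have "{\<omega> \<in> space M. X \<omega> > t} = space M - {\<omega> \<in> space M. X \<omega> \<le> t}"
    by auto
  ultimately show ?thesis
    using assms by (simp add: prob_compl)
qed

lemma (in prob_space) prob_all_gt:
  assumes indep: "indep_vars (\<lambda>_. borel) X I"
    and g: "\<And>i. i \<in> I \<Longrightarrow> prob {\<omega> \<in> space M. X i \<omega> > t} = g"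
    and J: "finite J" "J \<subseteq> I"
  shows "prob {\<omega> \<in> space M. \<forall>i\<in>J. X i \<omega> > (t::real)} = g ^ card J"
proof (cases "J = {}")
  case True
  then show ?thesis by (simp add: prob_space)
next
  case False
  have "prob (\<Inter>i\<in>J. X i -` {t<..} \<inter> space M) = (\<Prod>i\<in>J. prob (X i -` {t<..} \<inter> space M))"
    using J False by (intro indep_varsD[OF indep]) auto
  moreover have "(\<Inter>i\<in>J. X i -` {t<..} \<inter> space M) = {\<omega> \<in> space M. \<forall>i\<in>J. X i \<omega> > t}"
    using False by auto
  moreover have "X i -` {t<..} \<inter> space M = {\<omega> \<in> space M. X i \<omega> > t}" for i
    by auto
  ultimately show ?thesis
    using g J by (simp add: subset_eq)
qed

text \<open>
  If the minimum of the \<open>Y i\<close> exceeds \<open>c\<close>, it lies in some \<open>{c 2\<^sup>k<..c 2\<^sup>k\<^sup>+\<^sup>1}\<close>; then all \<open>Y i\<close> exceed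
  \<open>c 2\<^sup>k\<close>, which has probability \<open>G (c 2\<^sup>k)\<close> to the power of the number of variables. Hence the moment
  is at most \<open>c\<^sup>d\<close> plus \<open>(2 c)\<^sup>d\<close> times the sum of the series. For even \<open>d\<close>, nonnegativity is what
  makes the minimum of the powers equal to the power of the minimum.
\<close>

lemma (in prob_space) not_summable_dyadic_tail_of_min:
  fixes Y :: "'i::finite \<Rightarrow> 'a \<Rightarrow> real"
  assumes indep: "indep_vars (\<lambda>_. borel) Y UNIV"
    and nonneg: "\<And>i. AE \<omega> in M. 0 \<le> Y i \<omega>"
    and G: "\<And>i t. prob {\<omega> \<in> space M. Y i \<omega> > t} = G t"
    and inf: "(\<integral>\<^sup>+ \<omega>. ennreal (MIN i. Y i \<omega> ^ CARD('i)) \<partial>M) = \<infinity>"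
    and c: "c > 0"
  shows "\<not> summable (\<lambda>k::nat. (2 ^ k * G (c * 2 ^ k)) ^ CARD('i))"
proof
  define d where "d = CARD('i)"
  define B where "B k = {\<omega> \<in> space M. \<forall>i\<in>UNIV. Y i \<omega> > c * 2 ^ k}" for k :: nat
  assume "summable (\<lambda>k::nat. (2 ^ k * G (c * 2 ^ k)) ^ CARD('i))"
  then have "summable (\<lambda>k::nat. (2 * c) ^ d * (2 ^ k * G (c * 2 ^ k)) ^ d)"
    unfolding d_def by (rule summable_mult)
  moreover have "(2 * c) ^ d * (2 ^ k * G (c * 2 ^ k)) ^ d = (c * 2 ^ Suc k) ^ d * G (c * 2 ^ k) ^ d"
    for k
    by (simp add: power_mult_distrib)
  ultimately have sm: "summable (\<lambda>k. (c * 2 ^ Suc k) ^ d * G (c * 2 ^ k) ^ d)"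
    by (simp only:)
  have Y: "Y i \<in> borel_measurable M" for i
    using indep by (auto simp: indep_vars_def)
  have G0: "G t \<ge> 0" for t
    using G[of t undefined] by (metis measure_nonneg)
  have B: "B k \<in> events" for k
    unfolding B_def using Y by measurable
  have emB: "emeasure M (B k) = ennreal (G (c * 2 ^ k) ^ d)" for k
    using prob_all_gt[OF indep G, of UNIV] by (simp add: emeasure_eq_measure B_def d_def)
  have "AE \<omega> in M. \<forall>i. 0 \<le> Y i \<omega>"
    using nonneg by (simp add: AE_all_countable)
  then have "AE \<omega> in M. ennreal (MIN i. Y i \<omega> ^ CARD('i))
      \<le> ennreal (c ^ d) + (\<Sum>k. ennreal ((c * 2 ^ Suc k) ^ d) * indicator (B k) \<omega>)"
  proof (rule AE_mp, intro AE_I2 impI)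
    fix \<omega> assume \<omega>: "\<omega> \<in> space M" and pos: "\<forall>i. 0 \<le> Y i \<omega>"
    have le: "(MIN i. Y i \<omega> ^ CARD('i)) \<le> b ^ d" if "Y i \<omega> \<le> b" for i b
      using that pos unfolding d_def
      by (meson Min_le finite finite_imageI order_trans power_mono rangeI)
    show "ennreal (MIN i. Y i \<omega> ^ CARD('i))
      \<le> ennreal (c ^ d) + (\<Sum>k. ennreal ((c * 2 ^ Suc k) ^ d) * indicator (B k) \<omega>)"
    proof (cases "\<exists>i. Y i \<omega> \<le> c")
      case True
      then have "ennreal (MIN i. Y i \<omega> ^ CARD('i)) \<le> ennreal (c ^ d)"
        using le by (auto intro!: ennreal_leI)
      then show ?thesis
        by (simp add: add_increasing2)
    next
      case False
      define m where "m = (MIN i. Y i \<omega>)"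
      have m: "m \<le> Y i \<omega>" for i
        by (simp add: m_def)
      have "m \<in> range (\<lambda>i. Y i \<omega>)"
        unfolding m_def by (intro Min_in) auto
      then obtain i0 where i0: "m = Y i0 \<omega>" by auto
      obtain n0 :: nat where "m / c < 2 ^ n0"
        using real_arch_pow[of 2 "m / c"] by auto
      then have ex: "m \<le> c * 2 ^ n0"
        using c by (simp add: field_simps)
      \<comment> \<open>Here \<open>n > 0\<close> because \<open>m > c\<close>, so the scale with \<open>c * 2 ^ k < m \<le> c * 2 ^ Suc k\<close> is \<open>k = n - 1\<close>.\<close>
      define n where "n = (LEAST n. m \<le> c * 2 ^ n)"
      have n: "m \<le> c * 2 ^ n" unfolding n_def using ex by (rule LeastI)
      have "n \<noteq> 0" using n False i0 by (metis mult.right_neutral power_0)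
      then obtain k where k: "n = Suc k" by (cases n) auto
      then have "\<not> m \<le> c * 2 ^ k"
        unfolding n_def by (metis lessI not_less_Least)
      then have "\<omega> \<in> B k"
        using m \<omega> by (auto simp: B_def not_le intro: less_le_trans)
      have "ennreal (MIN i. Y i \<omega> ^ CARD('i)) \<le> ennreal ((c * 2 ^ Suc k) ^ d)"
        using le[of i0] n i0 k by (intro ennreal_leI) auto
      also have "\<dots> = ennreal ((c * 2 ^ Suc k) ^ d) * indicator (B k) \<omega>"
        using \<open>\<omega> \<in> B k\<close> by simp
      also have "\<dots> \<le> (\<Sum>k. ennreal ((c * 2 ^ Suc k) ^ d) * indicator (B k) \<omega>)"
        using sum_le_suminf[of "\<lambda>k. ennreal ((c * 2 ^ Suc k) ^ d) * indicator (B k) \<omega>" "{k}"]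
        by (simp del: power_Suc sum_mult_indicator)
      finally show ?thesis
        by (simp add: add_increasing)
    qed
  qed
  then have "(\<integral>\<^sup>+ \<omega>. ennreal (MIN i. Y i \<omega> ^ CARD('i)) \<partial>M)
      \<le> (\<integral>\<^sup>+ \<omega>. ennreal (c ^ d) + (\<Sum>k. ennreal ((c * 2 ^ Suc k) ^ d) * indicator (B k) \<omega>) \<partial>M)"
    by (rule nn_integral_mono_AE)
  also have "\<dots> = ennreal (c ^ d) + (\<Sum>k. ennreal ((c * 2 ^ Suc k) ^ d) * emeasure M (B k))"
    using B by (subst nn_integral_add) (auto simp: nn_integral_suminf nn_integral_cmult_indicator
        emeasure_space_1 simp del: power_Suc)
  also have "\<dots> = ennreal (c ^ d) + (\<Sum>k. ennreal ((c * 2 ^ Suc k) ^ d * G (c * 2 ^ k) ^ d))"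
    using c G0 by (simp add: emB ennreal_mult)
  also have "\<dots> = ennreal (c ^ d) + ennreal (\<Sum>k. (c * 2 ^ Suc k) ^ d * G (c * 2 ^ k) ^ d)"
    using c G0 by (subst suminf_ennreal2[OF _ sm]) (auto intro!: mult_nonneg_nonneg)
  also have "\<dots> < \<infinity>"
    by (simp add: less_top[symmetric])
  finally show False
    using inf by simp
qed

section \<open>Integer lines through a point\<close>

definition coord_line :: "'d \<Rightarrow> int ^ 'd \<Rightarrow> (int ^ 'd::finite) set" where
  "coord_line i x = {z. \<forall>j. j \<noteq> i \<longrightarrow> z $ j = x $ j}"

definition lines_through :: "int ^ 'd::finite \<Rightarrow> (int ^ 'd) set set" where
  "lines_through x = range (\<lambda>i. coord_line i x)"

lemma integer_line_through_eq:
  assumes "\<delta> \<in> integer_lines" "x \<in> \<delta>"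
  obtains i where "\<delta> = coord_line i x"
proof -
  obtain i y where y: "\<delta> = {z. \<forall>j. j \<noteq> i \<longrightarrow> z $ j = y $ j}"
    using assms(1) unfolding integer_lines_iff by blast
  with assms(2) have "\<delta> = coord_line i x"
    by (auto simp: coord_line_def)
  then show ?thesis by (rule that)
qed

lemma lines_through_eq: "lines_through x = {\<delta> \<in> integer_lines. x \<in> \<delta>}"
proof (intro set_eqI iffI)
  fix \<delta> assume "\<delta> \<in> lines_through x"
  then show "\<delta> \<in> {\<delta> \<in> integer_lines. x \<in> \<delta>}"
    unfolding lines_through_def integer_lines_iff coord_line_def by blast
next
  fix \<delta> assume "\<delta> \<in> {\<delta> \<in> integer_lines. x \<in> \<delta>}"
  then show "\<delta> \<in> lines_through x"
    by (auto simp: lines_through_def elim: integer_line_through_eq)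
qed

lemma finite_lines_through: "finite (lines_through x)"
  by (simp add: lines_through_def)

lemma coord_line_inj:
  fixes x :: "int ^ 'd::finite"
  assumes "coord_line i x = coord_line j x"
  shows "i = j"
proof (rule ccontr)
  assume "i \<noteq> j"
  have "x + axis i 1 \<in> coord_line i x"
    by (simp add: coord_line_def axis_def)
  then have "x + axis i 1 \<in> coord_line j x"
    by (simp add: assms)
  with \<open>i \<noteq> j\<close> show False
    by (auto simp: coord_line_def axis_def)
qed

lemma card_lines_through:
  fixes x :: "int ^ 'd::finite"
  shows "card (lines_through x) = CARD('d)"
  unfolding lines_through_def by (rule card_image) (auto intro!: injI coord_line_inj)

text \<open>
  Points on a common line agree in all coordinates except the direction of that line, so the
  direction has to be a coordinate in which the two points differ, and there is only one.
\<close>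

lemma card_common_lines_le_1:
  assumes "x \<noteq> y"
  shows "card (lines_through x \<inter> lines_through y) \<le> 1"
proof -
  have "\<delta> = \<delta>'" if d: "\<delta> \<in> lines_through x \<inter> lines_through y"
    and d': "\<delta>' \<in> lines_through x \<inter> lines_through y" for \<delta> \<delta>'
  proof -
    obtain i j where i: "\<delta> = coord_line i x" and j: "\<delta>' = coord_line j x"
      using d d' by (auto simp: lines_through_def)
    have "y \<in> \<delta>" "y \<in> \<delta>'" using d d' by (auto simp: lines_through_eq)
    then have "k \<noteq> i \<Longrightarrow> y $ k = x $ k" "k \<noteq> j \<Longrightarrow> y $ k = x $ k" for k
      using i j by (auto simp: coord_line_def)
    with assms have "i = j" by (metis vec_eq_iff)
    then show ?thesis using i j by simp
  qed
  then show ?thesis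
    by (auto simp: card_le_Suc0_iff_eq finite_lines_through)
qed

section \<open>Dyadic boxes on the diagonal\<close>

definition dyadic_box :: "nat \<Rightarrow> (int ^ 'd::finite) set" where
  "dyadic_box k = {x. \<forall>i. x $ i \<in> {2 ^ k..<2 ^ Suc k}}"

lemma
  shows finite_dyadic_box: "finite (dyadic_box k :: (int ^ 'd::finite) set)"
    and card_dyadic_box: "card (dyadic_box k :: (int ^ 'd::finite) set) = (2 ^ k) ^ CARD('d)"
proof -
  have bij: "bij_betw vec_nth (dyadic_box k :: (int ^ 'd) set)
      (PiE (UNIV :: 'd set) (\<lambda>_. {2 ^ k..<2 ^ Suc k :: int}))"
    by (rule bij_betw_byWitness[where f' = vec_lambda])
      (auto simp: dyadic_box_def vec_lambda_inverse)
  have fin: "finite (PiE (UNIV :: 'd set) (\<lambda>_. {2 ^ k..<2 ^ Suc k :: int}))"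
    by (intro finite_PiE) auto
  show "finite (dyadic_box k :: (int ^ 'd) set)"
    using bij fin bij_betw_finite by blast
  have "card (PiE (UNIV :: 'd set) (\<lambda>_. {2 ^ k..<2 ^ Suc k :: int})) = (2 ^ k) ^ CARD('d)"
    by (simp add: card_PiE nat_power_eq)
  then show "card (dyadic_box k :: (int ^ 'd) set) = (2 ^ k) ^ CARD('d)"
    using bij_betw_same_card[OF bij] by simp
qed

text \<open>
  A point of the line is determined by the one coordinate that varies along it.
\<close>

lemma card_dyadic_box_Int_coord_line:
  "card (dyadic_box k \<inter> coord_line i x) \<le> 2 ^ k"
proof -
  have "inj_on (\<lambda>z. z $ i) (dyadic_box k \<inter> coord_line i x)"
  proof (rule inj_onI)
    fix y z assume "y \<in> dyadic_box k \<inter> coord_line i x" "z \<in> dyadic_box k \<inter> coord_line i x" "y $ i = z $ i"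
    then have "y $ j = z $ j" for j by (cases "j = i") (auto simp: coord_line_def)
    then show "y = z" by (simp add: vec_eq_iff)
  qed
  moreover have "(\<lambda>z. z $ i) ` (dyadic_box k \<inter> coord_line i x) \<subseteq> {2 ^ k..<2 ^ Suc k}"
    by (auto simp: dyadic_box_def)
  ultimately have "card (dyadic_box k \<inter> coord_line i x) \<le> card {2 ^ k..<2 ^ Suc k :: int}"
    by (intro card_inj_on_le) auto
  then show ?thesis by (simp add: nat_power_eq)
qed

lemma card_dyadic_box_sharing_line:
  fixes x :: "int ^ 'd::finite"
  shows "card {y \<in> dyadic_box k. lines_through x \<inter> lines_through y \<noteq> {}} \<le> CARD('d) * 2 ^ k"
proof -
  have "{y \<in> dyadic_box k. lines_through x \<inter> lines_through y \<noteq> {}}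
      \<subseteq> (\<Union>i\<in>UNIV. dyadic_box k \<inter> coord_line i x)"
  proof
    fix y assume "y \<in> {y \<in> dyadic_box k. lines_through x \<inter> lines_through y \<noteq> {}}"
    then obtain \<delta> where y: "y \<in> dyadic_box k"
      and \<delta>: "\<delta> \<in> lines_through x" "\<delta> \<in> lines_through y" by blast
    then obtain i where "\<delta> = coord_line i x" by (auto simp: lines_through_def)
    moreover have "y \<in> \<delta>" using \<delta>(2) by (simp add: lines_through_eq)
    ultimately show "y \<in> (\<Union>i\<in>UNIV. dyadic_box k \<inter> coord_line i x)" using y by blast
  qed
  then have "card {y \<in> dyadic_box k. lines_through x \<inter> lines_through y \<noteq> {}}
      \<le> card (\<Union>i\<in>UNIV. dyadic_box k \<inter> coord_line i x)"
    by (intro card_mono) (auto simp: finite_dyadic_box)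
  also have "\<dots> \<le> (\<Sum>i\<in>UNIV. card (dyadic_box k \<inter> coord_line i x))"
    by (rule card_UN_le) simp
  also have "\<dots> \<le> (\<Sum>i\<in>(UNIV :: 'd set). 2 ^ k)"
    by (intro sum_mono card_dyadic_box_Int_coord_line)
  finally show ?thesis by simp
qed

lemma dyadic_interval_unique:
  assumes "(a::int) \<in> {2 ^ k..<2 ^ Suc k}" "a \<in> {2 ^ l..<2 ^ Suc l}"
  shows "k = l"
proof -
  have False if "a \<in> {2 ^ k..<2 ^ Suc k}" "a \<in> {2 ^ l..<2 ^ Suc l}" "k < l" for k l
  proof -
    have "(2::int) ^ Suc k \<le> 2 ^ l"
      using that by (intro power_increasing) auto
    with that show False by simp
  qed
  with assms show ?thesis by (metis linorder_neqE_nat)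
qed

lemma dyadic_box_disjoint: "x \<in> dyadic_box k \<Longrightarrow> x \<in> dyadic_box l \<Longrightarrow> k = l"
  unfolding dyadic_box_def mem_Collect_eq using dyadic_interval_unique by blast

definition box_lines :: "nat \<Rightarrow> (int ^ 'd::finite) set set" where
  "box_lines k = (\<Union>x\<in>dyadic_box k. lines_through x)"

text \<open>
  A line has a coordinate that is constant along it, because \<open>d \<ge> 2\<close>. At a point of box \<open>k\<close> this
  coordinate lies in \<open>{2\<^sup>k..<2\<^sup>k\<^sup>+\<^sup>1}\<close>, so it determines \<open>k\<close>. This is why the boxes are taken on the diagonal:
  dyadic annuli of the whole lattice have lines in common.
\<close>

lemma disjoint_box_lines:
  assumes "CARD('d::finite) \<ge> 2"
  shows "disjoint_family (box_lines :: nat \<Rightarrow> (int ^ 'd) set set)"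
  unfolding disjoint_family_on_def
proof (intro ballI impI, rule ccontr)
  fix k l :: nat
  assume "k \<noteq> l" and "box_lines k \<inter> (box_lines l :: (int ^ 'd) set set) \<noteq> {}"
  then obtain \<delta> and x y :: "int ^ 'd" where x: "x \<in> dyadic_box k" "\<delta> \<in> lines_through x"
    and y: "y \<in> dyadic_box l" "\<delta> \<in> lines_through y"
    by (auto simp: box_lines_def)
  from x obtain i where i: "\<delta> = coord_line i x" by (auto simp: lines_through_def)
  obtain j where "j \<noteq> i"
    using assms ex_card[of 2 "UNIV :: 'd set"] unfolding card_2_iff by metis
  have "y \<in> \<delta>" using y by (simp add: lines_through_eq)
  with i \<open>j \<noteq> i\<close> have "y $ j = x $ j" by (simp add: coord_line_def)
  with x(1) y(1) have "k = l"
    unfolding dyadic_box_def mem_Collect_eq using dyadic_interval_unique by metis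
  with \<open>k \<noteq> l\<close> show False by simp
qed

lemma norm_l1_dyadic_box:
  assumes "(x :: int ^ 'd::finite) \<in> dyadic_box k"
  shows "0 < norm_l1 x" "norm_l1 x \<le> int CARD('d) * 2 ^ Suc k"
proof -
  have x: "0 < \<bar>x $ i\<bar>" "\<bar>x $ i\<bar> \<le> 2 ^ Suc k" for i
  proof -
    have "2 ^ k \<le> x $ i" "x $ i < 2 ^ Suc k"
      using assms by (auto simp: dyadic_box_def)
    moreover have "(0::int) < 2 ^ k" by simp
    ultimately show "0 < \<bar>x $ i\<bar>" "\<bar>x $ i\<bar> \<le> 2 ^ Suc k" by linarith+
  qed
  show "0 < norm_l1 x"
    unfolding norm_l1_def by (intro sum_pos x(1)) auto
  have "norm_l1 x \<le> (\<Sum>i\<in>(UNIV :: 'd set). 2 ^ Suc k)"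
    unfolding norm_l1_def by (intro sum_mono x(2))
  then show "norm_l1 x \<le> int CARD('d) * 2 ^ Suc k" by simp
qed

section \<open>Paths end on a line through their endpoint\<close>

text \<open>
  The infimum that defines the passage time is informative only if some path exists. One is built
  by moving the endpoint one step towards the origin in a nonzero coordinate.
\<close>

lemma ex_lattice_path: "\<exists>\<Gamma>. lattice_path 0 (x :: int ^ 'd::finite) \<Gamma>"
proof (induction "nat (norm_l1 x)" arbitrary: x rule: less_induct)
  case less
  show ?case
  proof (cases "x = 0")
    case True
    then have "lattice_path 0 x [0]" by (simp add: lattice_path_def)
    then show ?thesis by blast
  next
    case False
    then obtain i where i: "x $ i \<noteq> 0" by (metis vec_eq_iff zero_index)
    define y where "y = x - axis i (sgn (x $ i))"
    have remove: "norm_l1 z = \<bar>z $ i\<bar> + (\<Sum>j\<in>UNIV - {i}. \<bar>z $ j\<bar>)" for z :: "int ^ 'd"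
      by (simp add: norm_l1_def sum.remove[of UNIV i])
    have "(\<Sum>j\<in>UNIV - {i}. \<bar>y $ j\<bar>) = (\<Sum>j\<in>UNIV - {i}. \<bar>x $ j\<bar>)"
      by (intro sum.cong) (auto simp: y_def axis_def)
    moreover have "\<bar>y $ i\<bar> = \<bar>x $ i\<bar> - 1"
      using i by (auto simp: y_def axis_def sgn_if)
    ultimately have "norm_l1 y = norm_l1 x - 1"
      by (simp add: remove)
    moreover have "norm_l1 x \<ge> \<bar>x $ i\<bar>"
      by (simp add: remove[of x] sum_nonneg)
    ultimately have "nat (norm_l1 y) < nat (norm_l1 x)"
      using i by simp
    then obtain \<Gamma> where \<Gamma>: "lattice_path 0 y \<Gamma>" using less by blast
    have "y - x = - axis i (sgn (x $ i))" by (simp add: y_def)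
    then have "norm_l1 (y - x) = 1"
      using i by (simp add: remove) (simp add: axis_def sgn_if)
    then have "{y, x} \<in> lattice_edges" by (auto simp: lattice_edges_def)
    with \<Gamma> have "lattice_path 0 x (\<Gamma> @ [x])"
      by (auto simp: lattice_path_def successively_append_iff)
    then show ?thesis by blast
  qed
qed

lemma edge_line_mem_lines_through:
  assumes "{u, x} \<in> lattice_edges"
  shows "edge_line {u, x} \<in> lines_through x"
  using theI'[OF ex1_edge_line[OF assms]] by (auto simp: edge_line_def lines_through_eq)

text \<open>
  The line is the one that carries the last edge of the path; all other edges cost at least \<open>0\<close>.
\<close>

lemma path_time_ge_last_line:
  fixes x :: "int ^ 'd::finite"
  assumes nonneg: "\<And>\<delta>. \<delta> \<in> integer_lines \<Longrightarrow> 0 \<le> t \<delta>"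
    and \<Gamma>: "lattice_path y x \<Gamma>" and "y \<noteq> x"
  shows "\<exists>\<delta>\<in>lines_through x. t \<delta> \<le> (\<Sum>e\<leftarrow>path_edges \<Gamma>. edge_time t e)"
proof -
  have edge: "\<exists>u v. e = {u, v} \<and> {u, v} \<in> lattice_edges" if "e \<in> set (path_edges \<Gamma>)" for e
  proof -
    from that obtain i where "i < length (tl \<Gamma>)" "e = {\<Gamma> ! i, tl \<Gamma> ! i}"
      by (auto simp: path_edges_def set_zip)
    with \<Gamma> show ?thesis
      by (fastforce simp: lattice_path_def successively_conv_nth nth_tl)
  qed
  have pos: "0 \<le> edge_time t e" if e: "e \<in> set (path_edges \<Gamma>)" for e
  proof -
    obtain u v where "e = {u, v}" "{u, v} \<in> lattice_edges" using edge[OF e] by blast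
    then show ?thesis
      using edge_line_mem_lines_through[of u v] nonneg
      by (auto simp: edge_time_def lines_through_eq)
  qed
  define n where "n = length \<Gamma>"
  have n: "n \<ge> 2"
  proof (rule ccontr)
    assume "\<not> n \<ge> 2"
    with \<Gamma> \<open>y \<noteq> x\<close> show False
      by (cases \<Gamma>) (auto simp: n_def lattice_path_def not_le split: if_splits)
  qed
  define e where "e = {\<Gamma> ! (n - 2), x}"
  have x: "x = \<Gamma> ! (n - 1)"
    using \<Gamma> by (auto simp: lattice_path_def last_conv_nth n_def)
  have "path_edges \<Gamma> ! (n - 2) = e"
    using n x by (simp add: path_edges_def n_def nth_tl e_def numeral_2_eq_2 Suc_diff_Suc)
  moreover have "n - 2 < length (path_edges \<Gamma>)"
    using n by (simp add: path_edges_def n_def)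
  ultimately have e: "e \<in> set (path_edges \<Gamma>)"
    by (metis nth_mem)
  have "e \<in> lattice_edges" using edge[OF e] by auto
  then have "edge_line e \<in> lines_through x"
    unfolding e_def by (rule edge_line_mem_lines_through)
  moreover have "edge_time t e \<le> (\<Sum>e\<leftarrow>path_edges \<Gamma>. edge_time t e)"
    using e pos by (intro member_le_sum_list) auto
  ultimately show ?thesis
    by (auto simp: edge_time_def)
qed

text \<open>
  The strict bound survives the infimum over paths because only the finitely many lines through
  \<open>x\<close> compete: their minimum is a uniform lower bound.
\<close>

lemma passage_time_gt:
  fixes x :: "int ^ 'd::finite"
  assumes nonneg: "\<And>\<delta>. \<delta> \<in> integer_lines \<Longrightarrow> 0 \<le> t \<delta>" and "x \<noteq> 0"
    and slow: "\<And>\<delta>. \<delta> \<in> lines_through x \<Longrightarrow> a < t \<delta>"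
  shows "a < passage_time t 0 x"
proof -
  have ne: "t ` lines_through x \<noteq> {}" "finite (t ` lines_through x)"
    by (auto simp: lines_through_def)
  have "a < Min (t ` lines_through x)"
    using slow ne by (subst Min_gr_iff) auto
  also have "\<dots> \<le> passage_time t 0 x"
    unfolding passage_time_def
  proof (rule cINF_greatest)
    show "{\<Gamma>. lattice_path 0 x \<Gamma>} \<noteq> {}" using ex_lattice_path by blast
    fix \<Gamma> assume "\<Gamma> \<in> {\<Gamma>. lattice_path 0 x \<Gamma>}"
    then obtain \<delta> where \<delta>: "\<delta> \<in> lines_through x" "t \<delta> \<le> (\<Sum>e\<leftarrow>path_edges \<Gamma>. edge_time t e)"
      using path_time_ge_last_line[of t 0 x \<Gamma>] nonneg \<open>x \<noteq> 0\<close> by auto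
    have "Min (t ` lines_through x) \<le> t \<delta>"
      using \<delta>(1) ne by (intro Min_le) auto
    with \<delta>(2) show "Min (t ` lines_through x) \<le> (\<Sum>e\<leftarrow>path_edges \<Gamma>. edge_time t e)"
      by simp
  qed
  finally show ?thesis .
qed

section \<open>Slow points in a dyadic box\<close>

text \<open>
  The second moment method for the number of slow points in the box. With \<open>n = 2\<^sup>k\<close>, a point
  contributes to the second moment \<open>g\<^sup>d\<close> with itself, \<open>g\<^sup>2\<^sup>d\<^sup>-\<^sup>1\<close> with each of the at most \<open>d n\<close> points that share
  exactly one line with it, and \<open>g\<^sup>2\<^sup>d\<close> with each of the others. The middle term is controlled by the
  mean \<open>m = (n g)\<^sup>d\<close> because \<open>n\<^sup>d\<^sup>+\<^sup>1 \<le> n\<^sup>2\<^sup>d\<^sup>-\<^sup>1\<close> for \<open>d \<ge> 2\<close>.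
\<close>

lemma (in prob_space) prob_slow_point_ge:
  fixes \<tau> :: "(int ^ 'd::finite) set \<Rightarrow> 'a \<Rightarrow> real"
  assumes dim: "CARD('d) \<ge> 2"
    and indep: "indep_vars (\<lambda>_. borel) \<tau> integer_lines"
    and g: "\<And>\<delta>. \<delta> \<in> integer_lines \<Longrightarrow> prob {\<omega> \<in> space M. \<tau> \<delta> \<omega> > t} = g"
  shows "min 1 ((2 ^ k * g) ^ CARD('d)) / (CARD('d) + 2)
    \<le> prob {\<omega> \<in> space M. \<exists>x\<in>dyadic_box k. \<forall>\<delta>\<in>lines_through x. \<tau> \<delta> \<omega> > t}"
proof -
  define d where "d = CARD('d)"
  define n :: real where "n = 2 ^ k"
  define m where "m = (n * g) ^ d"
  define D where "D = (dyadic_box k :: (int ^ 'd) set)"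
  define A where "A x = {\<omega> \<in> space M. \<forall>\<delta>\<in>lines_through x. \<tau> \<delta> \<omega> > t}" for x
  have d: "d \<ge> 2" using dim by (simp add: d_def)
  have n: "n \<ge> 1" by (simp add: n_def)
  have "coord_line undefined 0 \<in> (integer_lines :: (int ^ 'd) set set)"
    using lines_through_eq[of "0 :: int ^ 'd"] by (auto simp: lines_through_def)
  from g[OF this] have g01: "0 \<le> g" "g \<le> 1" by (metis measure_nonneg, metis prob_le_1)
  then have m0: "m \<ge> 0" using n by (simp add: m_def)
  have D: "finite D" "real (card D) = n ^ d"
    by (simp_all add: D_def finite_dyadic_box card_dyadic_box n_def d_def)
  have lines: "lines_through x \<subseteq> integer_lines" for x :: "int ^ 'd"
    by (auto simp: lines_through_eq)
  have meas: "\<tau> \<delta> \<in> borel_measurable M" if "\<delta> \<in> integer_lines" for \<delta>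
    using indep that by (auto simp: indep_vars_def)
  have A: "A x \<in> events" for x
    unfolding A_def using lines[of x] meas
    by (intro sets.sets_Collect_finite_All' borel_measurable_less finite_lines_through)
      (auto simp: lines_through_def)
  have PA: "prob (A x) = g ^ d" for x
    using prob_all_gt[OF indep g finite_lines_through lines]
    by (simp add: A_def card_lines_through d_def)
  have "A x \<inter> A y = {\<omega> \<in> space M. \<forall>\<delta>\<in>lines_through x \<union> lines_through y. \<tau> \<delta> \<omega> > t}" for x y
    by (auto simp: A_def)
  then have PAA: "prob (A x \<inter> A y) = g ^ card (lines_through x \<union> lines_through y)" for x y
    using prob_all_gt[OF indep g, of "lines_through x \<union> lines_through y"] lines
    by (simp add: finite_lines_through)
  have pair: "prob (A x \<inter> A y) \<le> (if y = x then g ^ d else 0)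
      + (if lines_through x \<inter> lines_through y \<noteq> {} then g ^ (2 * d - 1) else 0) + g ^ (2 * d)"
    for x y
  proof (cases "y = x")
    case True
    then show ?thesis using g01 by (simp add: PA)
  next
    case False
    have "card (lines_through x \<union> lines_through y) + card (lines_through x \<inter> lines_through y) = 2 * d"
      using card_Un_Int[OF finite_lines_through[of x] finite_lines_through[of y]]
      by (simp add: card_lines_through d_def)
    moreover have "card (lines_through x \<inter> lines_through y) \<le> 1"
      using False by (intro card_common_lines_le_1) auto
    ultimately have "card (lines_through x \<union> lines_through y) \<ge> 2 * d - 1"
      and "lines_through x \<inter> lines_through y = {} \<Longrightarrow> card (lines_through x \<union> lines_through y) = 2 * d"
      by auto
    then show ?thesis
      using g01 False by (auto simp: PAA intro!: add_increasing2 power_decreasing)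
  qed
  have row: "(\<Sum>y\<in>D. prob (A x \<inter> A y)) \<le> g ^ d + d * n * g ^ (2 * d - 1) + n ^ d * g ^ (2 * d)"
    if "x \<in> D" for x
  proof -
    let ?C = "{y \<in> D. lines_through x \<inter> lines_through y \<noteq> {}}"
    have "(\<Sum>y\<in>D. prob (A x \<inter> A y)) \<le> (\<Sum>y\<in>D. (if y = x then g ^ d else 0)
      + (if lines_through x \<inter> lines_through y \<noteq> {} then g ^ (2 * d - 1) else 0) + g ^ (2 * d))"
      by (intro sum_mono pair)
    also have "\<dots> = g ^ d + card ?C * g ^ (2 * d - 1) + n ^ d * g ^ (2 * d)"
      using D that by (simp add: sum.distrib sum.inter_filter[symmetric])
    also have "real (card ?C) \<le> d * n"
    proof -
      have "real (card ?C) \<le> real (d * 2 ^ k)"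
        unfolding D_def d_def by (rule of_nat_mono[OF card_dyadic_box_sharing_line])
      then show ?thesis by (simp add: n_def)
    qed
    finally show ?thesis
      using g01 by (simp add: mult_right_mono)
  qed
  have cross: "n ^ (d + 1) * g ^ (2 * d - 1) \<le> m * max 1 m"
  proof -
    have "n ^ (d + 1) * g ^ (2 * d - 1) \<le> n ^ (2 * d - 1) * g ^ (2 * d - 1)"
      using n d g01 by (intro mult_right_mono power_increasing) auto
    also have "\<dots> = (n * g) ^ (d + (d - 1))"
      using d by (simp add: power_mult_distrib mult_2)
    also have "\<dots> = m * (n * g) ^ (d - 1)"
      unfolding power_add m_def by simp
    also have "(n * g) ^ (d - 1) \<le> max 1 m"
    proof (cases "n * g \<le> 1")
      case True
      then have "(n * g) ^ (d - 1) \<le> 1"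
        using n g01 by (intro power_le_one) auto
      then show ?thesis by simp
    next
      case False
      then have "(n * g) ^ (d - 1) \<le> m"
        unfolding m_def by (intro power_increasing) auto
      then show ?thesis by simp
    qed
    finally show ?thesis
      using m0 by (simp add: mult_left_mono)
  qed
  have "(\<Sum>x\<in>D. \<Sum>y\<in>D. prob (A x \<inter> A y))
      \<le> (\<Sum>x\<in>D. g ^ d + d * n * g ^ (2 * d - 1) + n ^ d * g ^ (2 * d))"
    by (intro sum_mono row)
  also have "\<dots> = m * 1 + d * (n ^ (d + 1) * g ^ (2 * d - 1)) + m * m"
  proof -
    have "g ^ (2 * d) = g ^ d * g ^ d" by (simp add: mult_2 power_add)
    then show ?thesis
      using D by (simp add: m_def power_mult_distrib algebra_simps)
  qed
  also have "\<dots> \<le> m * max 1 m + d * (m * max 1 m) + m * max 1 m"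
    using cross m0 by (intro add_mono mult_left_mono) auto
  finally have V: "(\<Sum>x\<in>D. \<Sum>y\<in>D. prob (A x \<inter> A y)) \<le> (d + 2) * (m * max 1 m)"
    by (simp add: algebra_simps)
  \<comment> \<open>This is the mean \<open>m\<close> divided by the bound for the second moment, the optimal choice.\<close>
  define c where "c = 1 / ((d + 2) * max 1 m)"
  have "min 1 m / (d + 2) = c * m"
    using m0 by (auto simp: c_def min_def max_def)
  also have "\<dots> = 2 * c * m - c\<^sup>2 * ((d + 2) * (m * max 1 m))"
  proof -
    have "c * ((d + 2) * max 1 m) = 1" by (simp add: c_def)
    then have "c\<^sup>2 * ((d + 2) * (m * max 1 m)) = c * m"
      by (simp add: power2_eq_square mult_ac)
    then show ?thesis by linarith
  qed
  also have "\<dots> \<le> 2 * c * (\<Sum>x\<in>D. prob (A x)) - c\<^sup>2 * (\<Sum>x\<in>D. \<Sum>y\<in>D. prob (A x \<inter> A y))"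
    using mult_left_mono[OF V, of "c\<^sup>2"] by (simp add: PA D m_def power_mult_distrib)
  also have "\<dots> \<le> prob (\<Union>x\<in>D. A x)"
    using D A by (intro prob_UN_ge_second_moment) auto
  also have "(\<Union>x\<in>D. A x) = {\<omega> \<in> space M. \<exists>x\<in>D. \<forall>\<delta>\<in>lines_through x. \<tau> \<delta> \<omega> > t}"
    by (auto simp: A_def)
  finally show ?thesis
    by (simp add: m_def n_def d_def D_def)
qed

text \<open>
  The event at scale \<open>k\<close> depends only on the lines that meet box \<open>k\<close>, and these sets of lines are
  disjoint.
\<close>

lemma (in prob_space) indep_events_slow_point:
  fixes \<tau> :: "(int ^ 'd::finite) set \<Rightarrow> 'a \<Rightarrow> real"
  assumes dim: "CARD('d) \<ge> 2" and indep: "indep_vars (\<lambda>_. borel) \<tau> integer_lines"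
  shows "indep_events
    (\<lambda>k. {\<omega> \<in> space M. \<exists>x\<in>dyadic_box k. \<forall>\<delta>\<in>lines_through x. \<tau> \<delta> \<omega> > a k}) UNIV"
proof -
  let ?P = "\<lambda>k (f :: (int ^ 'd) set \<Rightarrow> real). \<exists>x\<in>dyadic_box k. \<forall>\<delta>\<in>lines_through x. f \<delta> > a k"
  have "box_lines k \<subseteq> (integer_lines :: (int ^ 'd) set set)" for k
    by (auto simp: box_lines_def lines_through_eq)
  then have "indep_vars (\<lambda>k. PiM (box_lines k) (\<lambda>_. borel))
      (\<lambda>k \<omega>. restrict (\<lambda>\<delta>. \<tau> \<delta> \<omega>) (box_lines k)) UNIV"
    using disjoint_box_lines[OF dim] by (intro indep_vars_restrict[OF indep])
  moreover have "{f \<in> space (PiM (box_lines k) (\<lambda>_. borel)). ?P k f}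
      \<in> sets (PiM (box_lines k) (\<lambda>_. borel))" for k
    by (intro sets.sets_Collect_finite_Ex sets.sets_Collect_finite_All' borel_measurable_less
        finite_dyadic_box finite_lines_through measurable_component_singleton borel_measurable_const)
      (auto simp: box_lines_def lines_through_def)
  ultimately have "indep_events
      (\<lambda>k. {\<omega> \<in> space M. ?P k (restrict (\<lambda>\<delta>. \<tau> \<delta> \<omega>) (box_lines k))}) UNIV"
    by (rule indep_eventsI_indep_vars)
  moreover have "?P k (restrict (\<lambda>\<delta>. \<tau> \<delta> \<omega>) (box_lines k)) \<longleftrightarrow> ?P k (\<lambda>\<delta>. \<tau> \<delta> \<omega>)" for k \<omega>
    by (intro bex_cong ball_cong refl) (auto simp: box_lines_def)
  ultimately show ?thesis by simp
qed

text \<open>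
  The terms tend to \<open>0\<close>, so the truncation at \<open>1\<close> is eventually inactive.
\<close>

lemma summable_of_summable_min_1:
  fixes f :: "nat \<Rightarrow> real"
  assumes "summable (\<lambda>k. min 1 (f k))"
  shows "summable f"
proof -
  have "eventually (\<lambda>k. min 1 (f k) < 1) sequentially"
    using summable_LIMSEQ_zero[OF assms] by (rule order_tendstoD) simp
  then have "eventually (\<lambda>k. min 1 (f k) = f k) sequentially"
    by eventually_elim auto
  then show ?thesis
    using assms by (subst (asm) summable_cong)
qed

section \<open>Passage times exceeding any linear rate\<close>

theorem proposition4p5:
  fixes M :: "'a measure" and \<tau> :: "(int ^ 'd::finite) set \<Rightarrow> 'a \<Rightarrow> real"
    and N :: "'b measure" and Y :: "'d \<Rightarrow> 'b \<Rightarrow> real"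
    and F :: "real \<Rightarrow> real" and K :: real
  assumes dim: "CARD('d) \<ge> 2"
    and M: "prob_space M"
    and tau_nonneg: "\<And>\<delta> \<omega>. \<delta> \<in> integer_lines \<Longrightarrow> \<omega> \<in> space M \<Longrightarrow> 0 \<le> \<tau> \<delta> \<omega>"
    and tau_indep: "prob_space.indep_vars M (\<lambda>_. borel) \<tau> integer_lines"
    and tau_cdf: "\<And>\<delta>. \<delta> \<in> integer_lines \<Longrightarrow> cdf (distr M borel (\<tau> \<delta>)) = F"
    and N: "prob_space N"
    and Y_indep: "prob_space.indep_vars N (\<lambda>_. borel) Y UNIV"
    and Y_cdf: "\<And>i. cdf (distr N borel (Y i)) = F"
    and min_moment: "(\<integral>\<^sup>+ \<omega>. ennreal (MIN i. Y i \<omega> ^ CARD('d)) \<partial>N) = \<infinity>"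
    and K: "K > 0"
  shows "AE \<omega> in M. infinite
    {x. passage_time (\<lambda>\<delta>. \<tau> \<delta> \<omega>) 0 x / real_of_int (norm_l1 x) > K}"
proof -
  interpret M: prob_space M by (rule M)
  interpret N: prob_space N by (rule N)
  define d where "d = CARD('d)"
  \<comment> \<open>Points of box \<open>k\<close> have norm at most \<open>d * 2 ^ Suc k\<close>, so \<open>c * 2 ^ k\<close> is at least \<open>K\<close> times their norm.\<close>
  define c where "c = 2 * d * K"
  define G where "G t = 1 - F t" for t
  define E where "E k = {\<omega> \<in> space M. \<exists>x\<in>dyadic_box k. \<forall>\<delta>\<in>lines_through x. \<tau> \<delta> \<omega> > c * 2 ^ k}" for k
  have c: "c > 0" using K dim by (simp add: c_def d_def)
  have tau: "\<tau> \<delta> \<in> borel_measurable M" if "\<delta> \<in> integer_lines" for \<delta>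
    using tau_indep that by (auto simp: M.indep_vars_def)
  have Y: "Y i \<in> borel_measurable N" for i
    using Y_indep by (auto simp: N.indep_vars_def)
  have tau_G: "M.prob {\<omega> \<in> space M. \<tau> \<delta> \<omega> > t} = G t" if "\<delta> \<in> integer_lines" for \<delta> t
    using M.prob_gt_eq_cdf[OF tau[OF that]] by (simp add: tau_cdf[OF that] G_def)
  have Y_G: "N.prob {\<omega> \<in> space N. Y i \<omega> > t} = G t" for i t
    using N.prob_gt_eq_cdf[OF Y] by (simp add: Y_cdf G_def)
  \<comment> \<open>Each \<open>Y i\<close> inherits this from \<open>\<tau>\<close>, since equal distribution functions give equal laws.\<close>
  have Y_nonneg: "AE \<omega> in N. 0 \<le> Y i \<omega>" for i
  proof -
    obtain \<delta> :: "(int ^ 'd) set" where \<delta>: "\<delta> \<in> integer_lines"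
      unfolding integer_lines_iff by blast
    have eq: "distr M borel (\<tau> \<delta>) = distr N borel (Y i)"
      using tau[OF \<delta>] Y by (intro cdf_unique) (simp_all add: tau_cdf[OF \<delta>] Y_cdf)
    have "AE x in distr M borel (\<tau> \<delta>). 0 \<le> x"
      using tau[OF \<delta>] tau_nonneg[OF \<delta>] by (subst AE_distr_iff) auto
    then have "AE x in distr N borel (Y i). 0 \<le> x"
      unfolding eq .
    then show ?thesis
      by (rule AE_distrD[OF Y])
  qed
  have "\<not> summable (\<lambda>k. M.prob (E k))"
  proof
    assume "summable (\<lambda>k. M.prob (E k))"
    then have "summable (\<lambda>k. (d + 2) * M.prob (E k))"
      by (rule summable_mult)
    then have "summable (\<lambda>k. min 1 ((2 ^ k * G (c * 2 ^ k)) ^ d))"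
    proof (rule summable_comparison_test'[where N = 0])
      fix k
      have "0 \<le> G (c * 2 ^ k)" using Y_G by (metis measure_nonneg)
      moreover have "min 1 ((2 ^ k * G (c * 2 ^ k)) ^ d) / (d + 2) \<le> M.prob (E k)"
        unfolding E_def d_def by (rule M.prob_slow_point_ge[OF dim tau_indep tau_G])
      ultimately show "norm (min 1 ((2 ^ k * G (c * 2 ^ k)) ^ d)) \<le> (d + 2) * M.prob (E k)"
        by (simp add: divide_le_eq mult.commute)
    qed
    then have "summable (\<lambda>k. (2 ^ k * G (c * 2 ^ k)) ^ d)"
      by (rule summable_of_summable_min_1)
    then show False
      using N.not_summable_dyadic_tail_of_min[OF Y_indep Y_nonneg Y_G min_moment c]
      by (simp add: d_def)
  qed
  then have "AE \<omega> in M. infinite {k. \<omega> \<in> E k}"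
    unfolding E_def by (intro M.borel_cantelli_AE2 M.indep_events_slow_point dim tau_indep)
  then show ?thesis
  proof (rule AE_mp, intro AE_I2 impI)
    fix \<omega> assume \<omega>: "\<omega> \<in> space M" and inf: "infinite {k. \<omega> \<in> E k}"
    let ?S = "{x. passage_time (\<lambda>\<delta>. \<tau> \<delta> \<omega>) 0 x / real_of_int (norm_l1 x) > K}"
    have "\<exists>x\<in>?S. x \<in> dyadic_box k" if "\<omega> \<in> E k" for k
    proof -
      obtain x where x: "x \<in> dyadic_box k"
        and slow: "\<And>\<delta>. \<delta> \<in> lines_through x \<Longrightarrow> c * 2 ^ k < \<tau> \<delta> \<omega>"
        using \<open>\<omega> \<in> E k\<close> by (auto simp: E_def)
      note norm = norm_l1_dyadic_box[OF x]
      then have "x \<noteq> 0" by (auto simp: norm_l1_def)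
      have "real_of_int (norm_l1 x) \<le> real_of_int (int d * 2 ^ Suc k)"
        using norm(2) unfolding d_def by (rule of_int_le_iff[THEN iffD2])
      then have "K * real_of_int (norm_l1 x) \<le> c * 2 ^ k"
        using K mult_left_mono[of _ _ K] by (fastforce simp: c_def mult_ac)
      also have "\<dots> < passage_time (\<lambda>\<delta>. \<tau> \<delta> \<omega>) 0 x"
        using tau_nonneg \<omega> slow \<open>x \<noteq> 0\<close> by (intro passage_time_gt) auto
      finally have "x \<in> ?S"
        using norm(1) by (simp add: less_divide_eq)
      with x show ?thesis by blast
    qed
    then obtain w where w: "\<And>k. \<omega> \<in> E k \<Longrightarrow> w k \<in> ?S" "\<And>k. \<omega> \<in> E k \<Longrightarrow> w k \<in> dyadic_box k"
      by metis
    have "inj_on w {k. \<omega> \<in> E k}"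
    proof (rule inj_onI)
      fix k l assume "k \<in> {k. \<omega> \<in> E k}" "l \<in> {k. \<omega> \<in> E k}" "w k = w l"
      then have "w k \<in> dyadic_box k" "w k \<in> dyadic_box l"
        using w(2)[of k] w(2)[of l] by auto
      then show "k = l" by (rule dyadic_box_disjoint)
    qed
    with inf have "infinite (w ` {k. \<omega> \<in> E k})"
      by (simp add: finite_image_iff)
    moreover have "w ` {k. \<omega> \<in> E k} \<subseteq> ?S"
      using w(1) by blast
    ultimately show "infinite ?S"
      by (rule infinite_super[rotated])
  qed
qed

end
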